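(* For every integer $n\ge 1$, let $P_n$ be the path graph on $n$ vertices and let $Sp(P_n)$ be its splitting graph. Then $$\gamma_{ds}(Sp(P_n)) = n+1.$$
   Context: All graphs are finite, simple and undirected. A set $S\subseteq V(G)$ is a dual-server dominating set (DS-dominating set) of a graph $G$ if there is a partition $\{R,B\}$ of $S$ such that every vertex of $V(G)\setminus S$ has at least one neighbour in $R$ and at least one neighbour in $B$. The dual-server domination number $\gamma_{ds}(G)$ is the minimum cardinality of a DS-dominating set of $G$. The splitting graph $Sp(G)$ of $G$ is obtained from $G$ by adding, for each vertex $v\in V(G)$, a new vertex $v'$ (the twin of $v$) adjacent exactly to the vertices of the open neighbourhood $N_G(v)$ of $v$ in $G$ (so twins are pairwise nonadjacent, and $v'$ is not adjacent to $v$). *)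

theory Defs
  imports "HOL-Library.Disjoint_Sets" "Graph_Theory.Pair_Digraph"
begin

text \<open>
  A finite simple undirected graph is a \<^locale>\<open>pair_graph\<close>: a finite, loop-free, symmetric
  digraph whose arcs are pairs of vertices, so that an undirected edge joining \<open>u\<close> and \<open>v\<close> is the
  pair of arcs \<open>(u, v)\<close>, \<open>(v, u)\<close>.
\<close>

definition open_nbhd :: "'a pair_pre_digraph \<Rightarrow> 'a \<Rightarrow> 'a set" where
  "open_nbhd G v = {u. (v, u) \<in> parcs G}"

text \<open>
  The parts of a partition are required to be distinct and, by \<^const>\<open>partition_on\<close>, nonempty.
  Allowing an empty part would change the domination number below only for graphs with at most one
  vertex: if a part is empty, then \<open>S\<close> is the whole vertex set, and any partition of it into two
  parts qualifies.
\<close>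

definition ds_dominating :: "'a pair_pre_digraph \<Rightarrow> 'a set \<Rightarrow> bool" where
  "ds_dominating G S \<longleftrightarrow> S \<subseteq> pverts G \<and>
     (\<exists>R B. R \<noteq> B \<and> partition_on S {R, B} \<and>
        (\<forall>v \<in> pverts G - S. open_nbhd G v \<inter> R \<noteq> {} \<and> open_nbhd G v \<inter> B \<noteq> {}))"

text \<open>
  The value is unspecified for a graph without DS-dominating sets, i.e. one with at most one vertex;
  see \<open>ds_dominating_pverts\<close>.
\<close>

definition ds_domination_number :: "'a pair_pre_digraph \<Rightarrow> nat" where
  "ds_domination_number G = (LEAST k. \<exists>S. ds_dominating G S \<and> card S = k)"

text \<open>\<open>Inl v\<close> is the original vertex \<open>v\<close> and \<open>Inr v\<close> is its twin.\<close>

definition splitting_graph :: "'a pair_pre_digraph \<Rightarrow> ('a + 'a) pair_pre_digraph" where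
  "splitting_graph G =
     \<lparr> pverts = Inl ` pverts G \<union> Inr ` pverts G,
       parcs = {(Inl u, Inl v) | u v. (u, v) \<in> parcs G}
             \<union> {(Inr v, Inl u) | u v. v \<in> pverts G \<and> u \<in> open_nbhd G v}
             \<union> {(Inl u, Inr v) | u v. v \<in> pverts G \<and> u \<in> open_nbhd G v} \<rparr>"

definition path_graph :: "nat \<Rightarrow> nat pair_pre_digraph" where
  "path_graph n =
     \<lparr> pverts = {1..n},
       parcs = {(i, j). i \<in> {1..n} \<and> j \<in> {1..n} \<and> (j = i + 1 \<or> i = j + 1)} \<rparr>"

lemma pair_graph_path_graph: "pair_graph (path_graph n)"
proof
  show "finite (parcs (path_graph n))"
    by (rule finite_subset[of _ "{1..n} \<times> {1..n}"]) (auto simp: path_graph_def)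
qed (auto simp: path_graph_def symmetric_def sym_def)

lemma pair_graph_splitting_graph:
  assumes "pair_graph G"
  shows "pair_graph (splitting_graph G)"
proof -
  interpret pair_graph G by fact
  have arcs: "u \<in> pverts G" "v \<in> pverts G" "(v, u) \<in> parcs G" "u \<noteq> v" if "(u, v) \<in> parcs G" for u v
    using that wellformed' pair_sym_arcs pair_no_loops[of "(u, v)"]
    by (auto simp: symmetric_def dest: symD)
  show ?thesis
  proof
    show "finite (parcs (splitting_graph G))"
      by (rule finite_subset[of _ "(Inl ` pverts G \<union> Inr ` pverts G) \<times> (Inl ` pverts G \<union> Inr ` pverts G)"])
         (auto simp: splitting_graph_def open_nbhd_def pair_finite_verts dest: arcs)
  qed (auto simp: splitting_graph_def open_nbhd_def symmetric_def pair_finite_verts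
            intro!: symI dest: arcs)
qed

lemma ds_dominating_pverts:
  assumes "2 \<le> card (pverts G)"
  shows "ds_dominating G (pverts G)"
proof -
  obtain a where a: "a \<in> pverts G" using assms by fastforce
  have ne: "pverts G - {a} \<noteq> {}"
  proof
    assume "pverts G - {a} = {}"
    then have "pverts G = {a}" using a by auto
    then show False using assms by simp
  qed
  have "partition_on (pverts G) {{a}, pverts G - {a}}"
    using a ne by (auto simp: partition_on_def disjoint_def)
  then show ?thesis
    unfolding ds_dominating_def by (intro conjI exI[of _ "{a}"] exI[of _ "pverts G - {a}"]) auto
qed

end

theory Submission
  imports Defs
begin

text \<open>
  Write \<open>i\<close> for a vertex of the path and \<open>i'\<close> for its twin. The neighbours of \<open>i'\<close> are \<open>i - 1\<close> and
  \<open>i + 1\<close>, as far as they exist, so a twin outside a DS-dominating set \<open>S\<close> forces both of them into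
  \<open>S\<close>, one in each part.

  Lower bound (\<open>ds_dominating_splitting_path_card_ge\<close>): let \<open>A\<close> be the set of path vertices in \<open>S\<close>
  and \<open>M\<close> the set of all path vertices whose twin is not in \<open>S\<close>. Then \<open>i \<mapsto> i + 1\<close> maps \<open>M\<close> injectively into \<open>A\<close>,
  and it misses the least element of \<open>A\<close>, since \<open>i - 1\<close> is in \<open>A\<close> as well. The set \<open>A\<close> is nonempty,
  because the vertex \<open>1\<close> has a single neighbour in the path: if \<open>1\<close> is not in \<open>S\<close>, then \<open>2\<close> and \<open>2'\<close> are
  its only neighbours and both must be. Hence the size of \<open>M\<close> is less than that of \<open>A\<close>,
  and \<open>S\<close> has \<open>n\<close> minus the size of \<open>M\<close> plus the size of \<open>A\<close> elements, which is at least \<open>n + 1\<close>.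

  Upper bound (\<open>even_ds_set_dominating\<close>, \<open>card_even_ds_set\<close>): for \<open>n \<ge> 2\<close> take the even path
  vertices, their twins, and those twins of end vertices that are not yet included. Let the even
  vertices alternate between the two parts, with each of their twins in the part opposite to it.
  An odd vertex sees some even \<open>j\<close> and its twin \<open>j'\<close>; the twin of an odd inner vertex sees two
  consecutive even vertices. For \<open>n = 1\<close> the whole vertex set has \<open>n + 1\<close> elements.
\<close>

lemma pverts_splitting_path:
  "pverts (splitting_graph (path_graph n)) = Inl ` {1..n} \<union> Inr ` {1..n}"
  by (simp add: splitting_graph_def path_graph_def)

lemma open_nbhd_splitting_path_Inl:
  "open_nbhd (splitting_graph (path_graph n)) (Inl i) =
    {w. \<exists>j. (w = Inl j \<or> w = Inr j) \<and> i \<in> {1..n} \<and> j \<in> {1..n} \<and> (j = i + 1 \<or> i = j + 1)}"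
  by (auto simp: open_nbhd_def splitting_graph_def path_graph_def)

lemma open_nbhd_splitting_path_Inr:
  "open_nbhd (splitting_graph (path_graph n)) (Inr i) =
    {Inl j | j. i \<in> {1..n} \<and> j \<in> {1..n} \<and> (j = i + 1 \<or> i = j + 1)}"
  by (auto simp: open_nbhd_def splitting_graph_def path_graph_def)

lemma ds_dominating_splitting_path_card_ge:
  assumes "n \<ge> 1" and "ds_dominating (splitting_graph (path_graph n)) S"
  shows "n + 1 \<le> card S"
proof -
  let ?G = "splitting_graph (path_graph n)"
  have S: "S \<subseteq> Inl ` {1..n} \<union> Inr ` {1..n}"
    using assms(2) unfolding ds_dominating_def pverts_splitting_path by (rule conjunct1)
  from assms(2) obtain R B where RB: "R \<noteq> B" and part: "partition_on S {R, B}"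
    and dom: "\<forall>v \<in> pverts ?G - S. open_nbhd ?G v \<inter> R \<noteq> {} \<and> open_nbhd ?G v \<inter> B \<noteq> {}"
    unfolding ds_dominating_def by (elim conjE exE)
  have SRB: "S = R \<union> B" and disj: "R \<inter> B = {}"
    using part RB by (auto simp: partition_on_def disjoint_def)
  define A where "A = {i. Inl i \<in> S}"
  define M where "M = {i \<in> {1..n}. Inr i \<notin> S}"
  have A_sub: "A \<subseteq> {1..n}" using S by (auto simp: A_def)
  then have finA: "finite A" using finite_subset by blast
  have two_nbrs: "\<exists>r b. r \<noteq> b \<and> r \<in> S \<and> b \<in> S \<and> r \<in> open_nbhd ?G v \<and> b \<in> open_nbhd ?G v"
    if "v \<in> pverts ?G" "v \<notin> S" for v
  proof -
    have "open_nbhd ?G v \<inter> R \<noteq> {}" "open_nbhd ?G v \<inter> B \<noteq> {}"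
      using dom that by auto
    then obtain r b where "r \<in> R" "r \<in> open_nbhd ?G v" "b \<in> B" "b \<in> open_nbhd ?G v"
      by (auto simp only: disjoint_iff)
    moreover from this have "r \<noteq> b" "r \<in> S" "b \<in> S" using SRB disj by auto
    ultimately show ?thesis by metis
  qed
  \<comment> \<open>If \<open>A\<close> were empty, only the twin of \<open>2\<close> could dominate the vertex \<open>1\<close>.\<close>
  have neA: "A \<noteq> {}"
  proof
    assume empty: "A = {}"
    have "Inl 1 \<in> pverts ?G" using assms(1) by (simp add: pverts_splitting_path)
    moreover have "Inl 1 \<notin> S" using empty by (auto simp: A_def)
    ultimately obtain r b where "r \<noteq> b" "r \<in> S" "b \<in> S"
      "r \<in> open_nbhd ?G (Inl 1)" "b \<in> open_nbhd ?G (Inl 1)"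
      using two_nbrs by metis
    moreover from this have "Inl 2 = r \<or> Inl 2 = b"
      by (auto simp: open_nbhd_splitting_path_Inl numeral_2_eq_2)
    ultimately show False using empty by (auto simp: A_def)
  qed
  have nbrs: "i - 1 \<in> A \<and> i + 1 \<in> A \<and> 1 \<le> i" if "i \<in> M" for i
  proof -
    from that have "Inr i \<in> pverts ?G" "Inr i \<notin> S" and "1 \<le> i"
      by (auto simp: M_def pverts_splitting_path)
    then obtain r b where rb: "r \<noteq> b" "r \<in> S" "b \<in> S"
      "r \<in> open_nbhd ?G (Inr i)" "b \<in> open_nbhd ?G (Inr i)"
      using two_nbrs by metis
    then show ?thesis using \<open>1 \<le> i\<close>
      by (auto simp: open_nbhd_splitting_path_Inr A_def)
  qed
  have "Suc ` M \<subseteq> A - {Min A}"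
  proof
    fix k assume "k \<in> Suc ` M"
    then obtain i where i: "k = Suc i" "i \<in> M" by auto
    have "Min A \<le> i - 1" using nbrs[OF i(2)] finA by simp
    then show "k \<in> A - {Min A}" using nbrs[OF i(2)] i(1) by auto
  qed
  then have "card (Suc ` M) \<le> card (A - {Min A})"
    using finA by (intro card_mono) auto
  then have "card M \<le> card A - 1"
    using finA neA by (simp add: card_image)
  moreover have "card A \<noteq> 0" using finA neA by simp
  moreover have "card S = card A + (n - card M)"
  proof -
    have "S = Inl ` A \<union> Inr ` ({1..n} - M)"
      using S by (auto simp: A_def M_def)
    then have "card S = card A + card ({1..n} - M)"
      using finA card_Plus[of A "{1..n} - M", unfolded Plus_def] by simp
    moreover have "card ({1..n} - M) = n - card M"
      by (subst card_Diff_subset) (auto simp: M_def)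
    ultimately show ?thesis by simp
  qed
  ultimately show ?thesis by linarith
qed

text \<open>
  The even path vertices, their twins, and the twins of the end vertices. Having at most one
  neighbour, the latter belong to every DS-dominating set.
\<close>

definition even_ds_set :: "nat \<Rightarrow> (nat + nat) set" where
  "even_ds_set n =
    Inl ` {i \<in> {1..n}. even i} \<union> Inr ` ({i \<in> {1..n}. even i} \<union> {1, n})"

lemma card_even_ds_set:
  assumes "n \<ge> 2"
  shows "card (even_ds_set n) = n + 1"
proof -
  let ?E = "{i \<in> {1..n}. even i}"
  have "?E = (*) 2 ` {1..n div 2}"
  proof (intro equalityI subsetI)
    fix i assume "i \<in> ?E"
    then have "i = 2 * (i div 2)" "i div 2 \<in> {1..n div 2}" by auto
    then show "i \<in> (*) 2 ` {1..n div 2}" by (rule image_eqI)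
  qed auto
  then have E: "card ?E = n div 2"
    by (simp add: card_image inj_on_def)
  have E': "card (?E \<union> {1, n}) = n div 2 + 1 + n mod 2"
  proof (cases "even n")
    case True
    then have "?E \<union> {1, n} = insert 1 ?E" using assms by auto
    then show ?thesis using True E by simp
  next
    case False
    then have "?E \<union> {1, n} = insert 1 (insert n ?E)" by auto
    then show ?thesis using False E assms by (simp add: odd_iff_mod_2_eq_one)
  qed
  have "card (even_ds_set n) = card ?E + card (?E \<union> {1, n})"
    unfolding even_ds_set_def
    by (rule card_Plus[unfolded Plus_def]) auto
  also have "\<dots> = n + 1"
    unfolding E E' by presburger
  finally show ?thesis .
qed

lemma even_ds_set_dominating:
  assumes "n \<ge> 2"
  shows "ds_dominating (splitting_graph (path_graph n)) (even_ds_set n)"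
proof -
  let ?G = "splitting_graph (path_graph n)"
  let ?S = "even_ds_set n"
  \<comment> \<open>Residues modulo 4 make consecutive even vertices alternate and put each even twin opposite to
    its original. The odd end twins, whose part does not matter, fall into \<open>R\<close>.\<close>
  define B where "B = ?S \<inter> (Inl ` {i. i mod 4 = 2} \<union> Inr ` {i. i mod 4 = 0})"
  define R where "R = ?S - B"
  have even: "even i" if "i mod 4 = 0 \<or> i mod 4 = 2" for i :: nat
    using that by presburger
  have B_Inl: "Inl i \<in> B" if "i \<in> {1..n}" "i mod 4 = 2" for i
    using that even[of i] by (simp add: B_def even_ds_set_def image_iff)
  have B_Inr: "Inr i \<in> B" if "i \<in> {1..n}" "i mod 4 = 0" for i
    using that even[of i] by (simp add: B_def even_ds_set_def image_iff)
  have R_Inl: "Inl i \<in> R" if "i \<in> {1..n}" "i mod 4 = 0" for i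
    using that even[of i] by (simp add: R_def B_def even_ds_set_def image_iff)
  have R_Inr: "Inr i \<in> R" if "i \<in> {1..n}" "i mod 4 = 2" for i
    using that even[of i] by (simp add: R_def B_def even_ds_set_def image_iff)
  have "Inl 2 \<in> B" "Inr 2 \<in> R" using B_Inl R_Inr assms by simp_all
  then have "partition_on ?S {R, B}" "R \<noteq> B"
    by (auto simp: partition_on_def disjoint_def R_def B_def)
  moreover have "?S \<subseteq> pverts ?G"
    using assms by (auto simp: even_ds_set_def pverts_splitting_path)
  moreover have "open_nbhd ?G v \<inter> R \<noteq> {} \<and> open_nbhd ?G v \<inter> B \<noteq> {}"
    if v: "v \<in> pverts ?G - ?S" for v
  proof (cases v)
    case (Inl i)
    then have i: "i \<in> {1..n}" "odd i"
      using v by (auto simp: pverts_splitting_path even_ds_set_def)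
    define j where "j = (if i = 1 then 2 else i - 1)"
    have j: "j \<in> {1..n}" "j = i + 1 \<or> i = j + 1" "even j"
      using i assms by (auto simp: j_def)
    then have "Inl j \<in> open_nbhd ?G v" "Inr j \<in> open_nbhd ?G v"
      using Inl i by (auto simp: open_nbhd_splitting_path_Inl)
    moreover have "j mod 4 = 0 \<or> j mod 4 = 2" using j(3) by presburger
    then have "Inl j \<in> R \<and> Inr j \<in> B \<or> Inl j \<in> B \<and> Inr j \<in> R"
      using R_Inl B_Inr B_Inl R_Inr j(1) by metis
    ultimately show ?thesis by (auto simp only: disjoint_iff)
  next
    case (Inr i)
    then have i: "i \<in> {1..n}" "odd i" "i \<noteq> 1" "i \<noteq> n"
      using v by (auto simp: pverts_splitting_path even_ds_set_def)
    define j where "j = i - 1"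
    have j: "even j" "j \<in> {1..n}" "j + 2 \<in> {1..n}" "i = j + 1"
      using i by (auto simp: j_def)
    then have "Inl j \<in> open_nbhd ?G v" "Inl (j + 2) \<in> open_nbhd ?G v"
      using Inr i by (auto simp: open_nbhd_splitting_path_Inr)
    moreover have "j mod 4 = 0 \<and> (j + 2) mod 4 = 2 \<or> j mod 4 = 2 \<and> (j + 2) mod 4 = 0"
      using j(1) by presburger
    then have "Inl j \<in> R \<and> Inl (j + 2) \<in> B \<or> Inl j \<in> B \<and> Inl (j + 2) \<in> R"
      using R_Inl B_Inl j(2,3) by metis
    ultimately show ?thesis by (auto simp only: disjoint_iff)
  qed
  ultimately show ?thesis
    unfolding ds_dominating_def by blast
qed

theorem theorem2p1:
  fixes n :: nat
  assumes "n \<ge> 1"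
  shows "ds_domination_number (splitting_graph (path_graph n)) = n + 1"
proof -
  let ?G = "splitting_graph (path_graph n)"
  have "\<exists>S. ds_dominating ?G S \<and> card S = n + 1"
  proof (cases "n = 1")
    case True
    have "card (pverts ?G) = 2"
      using True by (simp add: pverts_splitting_path)
    then show ?thesis
      using True ds_dominating_pverts[of ?G] by auto
  next
    case False
    then show ?thesis
      using assms even_ds_set_dominating[of n] card_even_ds_set[of n] by auto
  qed
  then show ?thesis
    unfolding ds_domination_number_def
    using ds_dominating_splitting_path_card_ge[OF assms] by (intro Least_equality) auto
qed

end
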